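(* Let $(L,[\cdot,\cdot]_L,\alpha)$ be a hom-Lie superalgebra over a field $\mathbf K$ of characteristic not equal to $2$ whose coadjoint representation $\pi$ exists, and let $\omega_1,\omega_2:L\times L\to L^*$ be two even supercyclic 2-cocycles. Then: (i) $T^*_{\omega_1}L$ is equivalent to $T^*_{\omega_2}L$ if and only if there is $z\in C^1(L,L^* )_{\bar 0}$ such that $$\omega_1(x,y)-\omega_2(x,y)=\pi(x)z(y)-(-1)^{|x||y|}\pi(y)z(x)-z([x,y]_L)\quad\text{for all homogeneous }x,y\in L.\qquad( * )$$ If this is the case, then the supersymmetric part $z_s$ of $z$, defined by $z_s(x)(y):=\frac12\big(z(x)(y)+(-1)^{|x||y|}z(y)(x)\big)$ for all homogeneous $x,y\in L$, induces a supersymmetric invariant bilinear form $(x,y)\mapsto z_s(x)(y)$ on $L$. (ii) $T^*_{\omega_1}L$ is isometrically equivalent to $T^*_{\omega_2}L$ if and only if there is $z\in C^1(L,L^* )_{\bar 0}$ such that $( * )$ holds and the supersymmetric part $z_s$ of $z$ vanishes.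
   Context: A hom-Lie superalgebra is a triple $(L,[\cdot,\cdot]_L,\alpha)$ with $L=L_{\bar 0}\oplus L_{\bar 1}$ a $\mathbb Z_2$-graded vector space over $\mathbf K$ ($|x|$ is the degree of homogeneous $x$), $[\cdot,\cdot]_L$ an even bilinear bracket and $\alpha:L\to L$ an even linear map such that for homogeneous $x,y,z$: $[x,y]_L=-(-1)^{|x||y|}[y,x]_L$ and $$(-1)^{|x||z|}[\alpha(x),[y,z]_L]_L+(-1)^{|y||x|}[\alpha(y),[z,x]_L]_L+(-1)^{|z||y|}[\alpha(z),[x,y]_L]_L=0.$$ A morphism $(L,[\cdot,\cdot]_L,\alpha)\to(\Gamma,[\cdot,\cdot]_\Gamma,\beta)$ is an even linear map $\phi$ with $\phi([u,v]_L)=[\phi(u),\phi(v)]_\Gamma$ and $\phi\circ\alpha=\beta\circ\phi$; an isomorphism is a bijective morphism. A bilinear form $f$ on $L$ is invariant if $f([x,y]_L,z)=f(x,[y,z]_L)$ and supersymmetric if $f(x,y)=(-1)^{|x||y|}f(y,x)$ for homogeneous elements. $L^*$ is the dual space, graded by $L^*_\theta=\{f\in L^*: f(x)=0 \text{ for homogeneous } x\text{ with }|x|\ne\theta\}$. $C^1(L,L^* )_{\bar 0}$ is the space of even linear maps $L\to L^*$. For $x\in L$ let $\mathrm{ad}(x)(y)=[x,y]_L$, and for $f\in L^*$ let $\pi(x)(f)(y)=-(-1)^{|x||f|}f([x,y]_L)$. The coadjoint representation $\pi$ exists if $\mathrm{ad}(x)\circ\mathrm{ad}(\alpha(y))-(-1)^{|x||y|}\mathrm{ad}(y)\circ\mathrm{ad}(\alpha(x))=\alpha\circ\mathrm{ad}([x,y]_L)$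 for all homogeneous $x,y\in L$. An even bilinear map $\omega:L\times L\to L^*$ is a 2-cocycle if $\omega(x,y)=-(-1)^{|x||y|}\omega(y,x)$ and, for all homogeneous $x,y,z$, $$\pi(\alpha(x))\omega(y,z)-(-1)^{|x||y|}\pi(\alpha(y))\omega(x,z)+(-1)^{(|x|+|y|)|z|}\pi(\alpha(z))\omega(x,y)+\omega(\alpha(x),[y,z]_L)+(-1)^{|y||z|}\omega([x,z]_L,\alpha(y))-\omega([x,y]_L,\alpha(z))=0.$$ It is supercyclic if $\omega(x,y)(z)=(-1)^{|x|(|y|+|z|)}\omega(y,z)(x)$ for all homogeneous $x,y,z$. The $T^*$-extension $T^*_\omega L$ of $L$ by an even supercyclic 2-cocycle $\omega$ is the hom-Lie superalgebra on $L\oplus L^*$ (graded by $L_\theta\oplus L^*_\theta$) with bracket, for homogeneous $x+f$, $y+g$ ($|x+f|=|x|=|f|$, etc.), $$[x+f,y+g]_{L\oplus L^*}=[x,y]_L+\omega(x,y)+\pi(x)g-(-1)^{|x||y|}\pi(y)f,$$ twist $\alpha'(x+f)=\alpha(x)+f\circ\alpha$, and bilinear form $q_L(x+f,y+g)=f(y)+(-1)^{|x||y|}g(x)$. $T^*_{\omega_1}L$ and $T^*_{\omega_2}L$ are equivalent if there is an isomorphism of hom-Lie superalgebras $\phi:T^*_{\omega_1}L\to T^*_{\omega_2}L$ which is the identity on the ideal $L^*$ and induces the identity on the factor $T^*_{\omega_1}L/L^*\cong L\cong T^*_{\omega_2}L/L^*$. They are isometrically equivalent if they are equivalent via such a $\phi$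 which is moreover an isometry, i.e. $q_L(\phi(a),\phi(b))=q_L(a,b)$ for all $a,b$.
   Formalization: In (i) and (ii) the map z is also required to satisfy z(α(x)) = z(x)∘α for all x; without this the "if" directions are false, since ( * ) does not make x+f ↦ x+z(x)+f (or any equivalence) commute with the twists. The claim about z_s is kept for every even z satisfying ( * ). *)

theory Defs
  imports
    Complex_Main
    "HOL-Library.Z2"
    "HOL-Library.Function_Algebras"
    "HOL-Library.Product_Plus"
begin

text \<open>Degrees live in the two-element field \<open>bit\<close>, so \<open>|x||y|\<close> and \<open>|x| + |y|\<close> are its
  product and sum.\<close>

definition ksign :: "bit \<Rightarrow> 'k::field" where
  "ksign d = (if d = 0 then 1 else - 1)"


subsection \<open>Super vector spaces\<close>

text \<open>The underlying space is the subspace \<open>part V 0 + part V 1\<close> of an ambient vector space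
  given by a type; values of functions outside that subspace are irrelevant.\<close>

record ('k, 'v) super_space =
  scal :: "'k \<Rightarrow> 'v \<Rightarrow> 'v"
  part :: "bit \<Rightarrow> 'v set"

definition space_of :: "('k, 'v::ab_group_add, 'm) super_space_scheme \<Rightarrow> 'v set" where
  "space_of V = {u + v | u v. u \<in> part V 0 \<and> v \<in> part V 1}"

definition super_vector_space ::
  "('k::field, 'v::ab_group_add, 'm) super_space_scheme \<Rightarrow> bool" where
  "super_vector_space V \<longleftrightarrow>
     vector_space (scal V) \<and> (\<forall>d. module.subspace (scal V) (part V d)) \<and>
     part V 0 \<inter> part V 1 = {0}"

text \<open>Homogeneous component of degree \<open>d\<close>; \<open>d + 1\<close> is the other degree.\<close>

definition hcomp ::
  "('k, 'v::ab_group_add, 'm) super_space_scheme \<Rightarrow> bit \<Rightarrow> 'v \<Rightarrow> 'v" where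
  "hcomp V d x = (THE u. u \<in> part V d \<and> x - u \<in> part V (d + 1))"

definition linear_map ::
  "('k, 'v::ab_group_add, 'm) super_space_scheme \<Rightarrow>
   ('k, 'w::ab_group_add, 'n) super_space_scheme \<Rightarrow> ('v \<Rightarrow> 'w) \<Rightarrow> bool" where
  "linear_map V W f \<longleftrightarrow>
     (\<forall>x\<in>space_of V. f x \<in> space_of W) \<and>
     (\<forall>x\<in>space_of V. \<forall>y\<in>space_of V. f (x + y) = f x + f y) \<and>
     (\<forall>c. \<forall>x\<in>space_of V. f (scal V c x) = scal W c (f x))"

definition bilinear_map ::
  "('k, 'v::ab_group_add, 'm) super_space_scheme \<Rightarrow>
   ('k, 'w::ab_group_add, 'n) super_space_scheme \<Rightarrow>
   ('k, 'u::ab_group_add, 'l) super_space_scheme \<Rightarrow> ('v \<Rightarrow> 'w \<Rightarrow> 'u) \<Rightarrow> bool" where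
  "bilinear_map V W U B \<longleftrightarrow>
     (\<forall>x\<in>space_of V. linear_map W U (B x)) \<and>
     (\<forall>y\<in>space_of W. linear_map V U (\<lambda>x. B x y))"

definition even_linear_map ::
  "('k, 'v::ab_group_add, 'm) super_space_scheme \<Rightarrow>
   ('k, 'w::ab_group_add, 'n) super_space_scheme \<Rightarrow> ('v \<Rightarrow> 'w) \<Rightarrow> bool" where
  "even_linear_map V W f \<longleftrightarrow>
     linear_map V W f \<and> (\<forall>d. \<forall>x\<in>part V d. f x \<in> part W d)"

definition even_bilinear_map ::
  "('k, 'v::ab_group_add, 'm) super_space_scheme \<Rightarrow>
   ('k, 'w::ab_group_add, 'n) super_space_scheme \<Rightarrow>
   ('k, 'u::ab_group_add, 'l) super_space_scheme \<Rightarrow> ('v \<Rightarrow> 'w \<Rightarrow> 'u) \<Rightarrow> bool" where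
  "even_bilinear_map V W U B \<longleftrightarrow>
     bilinear_map V W U B \<and>
     (\<forall>a b. \<forall>x\<in>part V a. \<forall>y\<in>part W b. B x y \<in> part U (a + b))"

text \<open>Formulas given for homogeneous arguments with a sign \<open>(-1)\<^bsup>|x||y|\<^esup>\<close> are extended
  bilinearly: for bilinear \<open>B\<close>, this is the bilinear map which on homogeneous \<open>x\<close>, \<open>y\<close> equals
  \<open>(-1)\<^bsup>|x||y|\<^esup> B x y\<close>.  The argument \<open>s\<close> is the scalar multiplication of the target.\<close>

definition signed ::
  "('k::field \<Rightarrow> 'u \<Rightarrow> 'u) \<Rightarrow> ('k, 'v::ab_group_add, 'm) super_space_scheme \<Rightarrow>
   ('k, 'w::ab_group_add, 'n) super_space_scheme \<Rightarrow> ('v \<Rightarrow> 'w \<Rightarrow> 'u::ab_group_add) \<Rightarrow>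
   'v \<Rightarrow> 'w \<Rightarrow> 'u" where
  "signed s V W B x y =
     (\<Sum>a\<in>{0, 1}. \<Sum>b\<in>{0, 1}. s (ksign (a * b)) (B (hcomp V a x) (hcomp W b y)))"

definition ground :: "('k::field, 'k) super_space" where
  "ground = \<lparr>scal = (*), part = (\<lambda>d. if d = 0 then UNIV else {0})\<rparr>"

text \<open>Functionals are functions on the ambient type, normalised to vanish outside the space so
  that each functional has a unique representative.\<close>

definition dual ::
  "('k::field, 'v::ab_group_add, 'm) super_space_scheme \<Rightarrow> ('k, 'v \<Rightarrow> 'k) super_space" where
  "dual V =
     \<lparr>scal = (\<lambda>c f y. c * f y),
      part = (\<lambda>d. {f. linear_map V ground f \<and> (\<forall>y. y \<notin> space_of V \<longrightarrow> f y = 0) \<and>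
                      (\<forall>e. e \<noteq> d \<longrightarrow> (\<forall>y\<in>part V e. f y = 0))})\<rparr>"


subsection \<open>Hom-Lie superalgebras\<close>

record ('k, 'v) hom_superalgebra = "('k, 'v) super_space" +
  brk :: "'v \<Rightarrow> 'v \<Rightarrow> 'v"
  twist :: "'v \<Rightarrow> 'v"

definition hom_lie_superalgebra ::
  "('k::field, 'v::ab_group_add) hom_superalgebra \<Rightarrow> bool" where
  "hom_lie_superalgebra L \<longleftrightarrow>
     super_vector_space L \<and>
     even_bilinear_map L L L (brk L) \<and>
     even_linear_map L L (twist L) \<and>
     (\<forall>a b. \<forall>x\<in>part L a. \<forall>y\<in>part L b. brk L x y = - scal L (ksign (a * b)) (brk L y x)) \<and>
     (\<forall>a b c. \<forall>x\<in>part L a. \<forall>y\<in>part L b. \<forall>z\<in>part L c.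
        scal L (ksign (a * c)) (brk L (twist L x) (brk L y z)) +
        scal L (ksign (b * a)) (brk L (twist L y) (brk L z x)) +
        scal L (ksign (c * b)) (brk L (twist L z) (brk L x y)) = 0)"

definition hom_morphism ::
  "('k::field, 'v::ab_group_add) hom_superalgebra \<Rightarrow>
   ('k, 'w::ab_group_add) hom_superalgebra \<Rightarrow> ('v \<Rightarrow> 'w) \<Rightarrow> bool" where
  "hom_morphism L M \<phi> \<longleftrightarrow>
     even_linear_map L M \<phi> \<and>
     (\<forall>u\<in>space_of L. \<forall>v\<in>space_of L. \<phi> (brk L u v) = brk M (\<phi> u) (\<phi> v)) \<and>
     (\<forall>u\<in>space_of L. \<phi> (twist L u) = twist M (\<phi> u))"

definition hom_isomorphism ::
  "('k::field, 'v::ab_group_add) hom_superalgebra \<Rightarrow>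
   ('k, 'w::ab_group_add) hom_superalgebra \<Rightarrow> ('v \<Rightarrow> 'w) \<Rightarrow> bool" where
  "hom_isomorphism L M \<phi> \<longleftrightarrow>
     hom_morphism L M \<phi> \<and> bij_betw \<phi> (space_of L) (space_of M)"

definition supersymmetric ::
  "('k::field, 'v::ab_group_add) hom_superalgebra \<Rightarrow> ('v \<Rightarrow> 'v \<Rightarrow> 'k) \<Rightarrow> bool" where
  "supersymmetric L B \<longleftrightarrow>
     (\<forall>a b. \<forall>x\<in>part L a. \<forall>y\<in>part L b. B x y = ksign (a * b) * B y x)"

definition invariant ::
  "('k::field, 'v::ab_group_add) hom_superalgebra \<Rightarrow> ('v \<Rightarrow> 'v \<Rightarrow> 'k) \<Rightarrow> bool" where
  "invariant L B \<longleftrightarrow>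
     (\<forall>x\<in>space_of L. \<forall>y\<in>space_of L. \<forall>z\<in>space_of L. B (brk L x y) z = B x (brk L y z))"


subsection \<open>Coadjoint representation and cocycles\<close>

definition coadjoint_exists ::
  "('k::field, 'v::ab_group_add) hom_superalgebra \<Rightarrow> bool" where
  "coadjoint_exists L \<longleftrightarrow>
     (\<forall>a b. \<forall>x\<in>part L a. \<forall>y\<in>part L b. \<forall>u\<in>space_of L.
        brk L x (brk L (twist L y) u) - scal L (ksign (a * b)) (brk L y (brk L (twist L x) u)) =
        twist L (brk L (brk L x y) u))"

text \<open>\<open>coadj L x f\<close> is \<open>\<pi>(x)(f)\<close>.\<close>

definition coadj ::
  "('k::field, 'v::ab_group_add) hom_superalgebra \<Rightarrow> 'v \<Rightarrow> ('v \<Rightarrow> 'k) \<Rightarrow> 'v \<Rightarrow> 'k" where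
  "coadj L x f =
     - signed (scal (dual L)) L (dual L)
         (\<lambda>x f y. if y \<in> space_of L then f (brk L x y) else 0) x f"

definition dual_twist ::
  "('k::field, 'v::ab_group_add) hom_superalgebra \<Rightarrow> ('v \<Rightarrow> 'k) \<Rightarrow> 'v \<Rightarrow> 'k" where
  "dual_twist L f = (\<lambda>y. if y \<in> space_of L then f (twist L y) else 0)"

text \<open>The space \<open>C\<^sup>1(L, L\<^sup>*)\<close> of even 1-cochains.\<close>

definition even_cochain1 ::
  "('k::field, 'v::ab_group_add) hom_superalgebra \<Rightarrow> ('v \<Rightarrow> 'v \<Rightarrow> 'k) set" where
  "even_cochain1 L = {z. even_linear_map L (dual L) z}"

definition even_cocycle2 ::
  "('k::field, 'v::ab_group_add) hom_superalgebra \<Rightarrow> ('v \<Rightarrow> 'v \<Rightarrow> 'v \<Rightarrow> 'k) \<Rightarrow> bool" where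
  "even_cocycle2 L \<omega> \<longleftrightarrow>
     even_bilinear_map L L (dual L) \<omega> \<and>
     (\<forall>a b. \<forall>x\<in>part L a. \<forall>y\<in>part L b. \<omega> x y = - scal (dual L) (ksign (a * b)) (\<omega> y x)) \<and>
     (\<forall>a b c. \<forall>x\<in>part L a. \<forall>y\<in>part L b. \<forall>z\<in>part L c.
        coadj L (twist L x) (\<omega> y z)
        - scal (dual L) (ksign (a * b)) (coadj L (twist L y) (\<omega> x z))
        + scal (dual L) (ksign ((a + b) * c)) (coadj L (twist L z) (\<omega> x y))
        + \<omega> (twist L x) (brk L y z)
        + scal (dual L) (ksign (b * c)) (\<omega> (brk L x z) (twist L y))
        - \<omega> (brk L x y) (twist L z) = 0)"

definition supercyclic ::
  "('k::field, 'v::ab_group_add) hom_superalgebra \<Rightarrow> ('v \<Rightarrow> 'v \<Rightarrow> 'v \<Rightarrow> 'k) \<Rightarrow> bool" where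
  "supercyclic L \<omega> \<longleftrightarrow>
     (\<forall>a b c. \<forall>x\<in>part L a. \<forall>y\<in>part L b. \<forall>z\<in>part L c.
        \<omega> x y z = ksign (a * (b + c)) * \<omega> y z x)"


subsection \<open>\<open>T\<^sup>*\<close>-extensions\<close>

text \<open>The pair \<open>(x, f)\<close> is \<open>x + f\<close>.  A homogeneous \<open>x + f\<close> has \<open>|x| = |f|\<close>, so in the last
  term of the bracket and of the form the sign is that of the pair of arguments occurring
  there, \<open>(y, f)\<close> and \<open>(x, g)\<close> respectively.\<close>

definition Tstar ::
  "('k::field, 'v::ab_group_add) hom_superalgebra \<Rightarrow> ('v \<Rightarrow> 'v \<Rightarrow> 'v \<Rightarrow> 'k) \<Rightarrow>
   ('k, 'v \<times> ('v \<Rightarrow> 'k)) hom_superalgebra" where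
  "Tstar L \<omega> =
     \<lparr>scal = (\<lambda>c (x, f). (scal L c x, scal (dual L) c f)),
      part = (\<lambda>d. part L d \<times> part (dual L) d),
      brk = (\<lambda>(x, f) (y, g).
        (brk L x y,
         \<omega> x y + coadj L x g - signed (scal (dual L)) L (dual L) (coadj L) y f)),
      twist = (\<lambda>(x, f). (twist L x, dual_twist L f))\<rparr>"

definition q_form ::
  "('k::field, 'v::ab_group_add) hom_superalgebra \<Rightarrow>
   'v \<times> ('v \<Rightarrow> 'k) \<Rightarrow> 'v \<times> ('v \<Rightarrow> 'k) \<Rightarrow> 'k" where
  "q_form L = (\<lambda>(x, f) (y, g). f y + signed (*) L (dual L) (\<lambda>x g. g x) x g)"

definition equivalence_map ::
  "('k::field, 'v::ab_group_add) hom_superalgebra \<Rightarrow>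
   ('v \<Rightarrow> 'v \<Rightarrow> 'v \<Rightarrow> 'k) \<Rightarrow> ('v \<Rightarrow> 'v \<Rightarrow> 'v \<Rightarrow> 'k) \<Rightarrow>
   ('v \<times> ('v \<Rightarrow> 'k) \<Rightarrow> 'v \<times> ('v \<Rightarrow> 'k)) \<Rightarrow> bool" where
  "equivalence_map L \<omega>\<^sub>1 \<omega>\<^sub>2 \<phi> \<longleftrightarrow>
     hom_isomorphism (Tstar L \<omega>\<^sub>1) (Tstar L \<omega>\<^sub>2) \<phi> \<and>
     (\<forall>f\<in>space_of (dual L). \<phi> (0, f) = (0, f)) \<and>
     (\<forall>x\<in>space_of L. \<forall>f\<in>space_of (dual L). fst (\<phi> (x, f)) = x)"

definition Tstar_equivalent ::
  "('k::field, 'v::ab_group_add) hom_superalgebra \<Rightarrow>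
   ('v \<Rightarrow> 'v \<Rightarrow> 'v \<Rightarrow> 'k) \<Rightarrow> ('v \<Rightarrow> 'v \<Rightarrow> 'v \<Rightarrow> 'k) \<Rightarrow> bool" where
  "Tstar_equivalent L \<omega>\<^sub>1 \<omega>\<^sub>2 \<longleftrightarrow> (\<exists>\<phi>. equivalence_map L \<omega>\<^sub>1 \<omega>\<^sub>2 \<phi>)"

definition Tstar_isometrically_equivalent ::
  "('k::field, 'v::ab_group_add) hom_superalgebra \<Rightarrow>
   ('v \<Rightarrow> 'v \<Rightarrow> 'v \<Rightarrow> 'k) \<Rightarrow> ('v \<Rightarrow> 'v \<Rightarrow> 'v \<Rightarrow> 'k) \<Rightarrow> bool" where
  "Tstar_isometrically_equivalent L \<omega>\<^sub>1 \<omega>\<^sub>2 \<longleftrightarrow>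
     (\<exists>\<phi>. equivalence_map L \<omega>\<^sub>1 \<omega>\<^sub>2 \<phi> \<and>
        (\<forall>u\<in>space_of (Tstar L \<omega>\<^sub>1). \<forall>v\<in>space_of (Tstar L \<omega>\<^sub>1).
           q_form L (\<phi> u) (\<phi> v) = q_form L u v))"

definition differ_by_coboundary ::
  "('k::field, 'v::ab_group_add) hom_superalgebra \<Rightarrow>
   ('v \<Rightarrow> 'v \<Rightarrow> 'v \<Rightarrow> 'k) \<Rightarrow> ('v \<Rightarrow> 'v \<Rightarrow> 'v \<Rightarrow> 'k) \<Rightarrow> ('v \<Rightarrow> 'v \<Rightarrow> 'k) \<Rightarrow> bool" where
  "differ_by_coboundary L \<omega>\<^sub>1 \<omega>\<^sub>2 z \<longleftrightarrow>
     (\<forall>a b. \<forall>x\<in>part L a. \<forall>y\<in>part L b.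
        \<omega>\<^sub>1 x y - \<omega>\<^sub>2 x y =
        coadj L x (z y) - scal (dual L) (ksign (a * b)) (coadj L y (z x)) - z (brk L x y))"

text \<open>The condition \<open>z \<circ> \<alpha> = \<alpha>\<^sup>* \<circ> z\<close>, which says that \<open>x + f \<mapsto> x + z(x) + f\<close> commutes with
  the twist of the \<open>T\<^sup>*\<close>-extension.\<close>

definition twist_compatible ::
  "('k::field, 'v::ab_group_add) hom_superalgebra \<Rightarrow> ('v \<Rightarrow> 'v \<Rightarrow> 'k) \<Rightarrow> bool" where
  "twist_compatible L z \<longleftrightarrow> (\<forall>x\<in>space_of L. z (twist L x) = dual_twist L (z x))"

text \<open>Supersymmetric part, as a bilinear form on \<open>L\<close>.\<close>

definition supersym_part ::
  "('k::field, 'v::ab_group_add) hom_superalgebra \<Rightarrow> ('v \<Rightarrow> 'v \<Rightarrow> 'k) \<Rightarrow> 'v \<Rightarrow> 'v \<Rightarrow> 'k" where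
  "supersym_part L z x y = 1 / 2 * (z x y + signed (*) L L (\<lambda>x y. z y x) x y)"

end

theory Submission
  imports Defs
begin

text \<open>A linear map \<open>\<phi>\<close> of \<open>L \<oplus> L\<^sup>*\<close> that is the identity on \<open>L\<^sup>*\<close> and on the quotient by \<open>L\<^sup>*\<close> is a
  shear \<open>x + f \<mapsto> x + z(x) + f\<close>, where \<open>z(x)\<close> is the \<open>L\<^sup>*\<close>-component of \<open>\<phi>(x)\<close>
  (\<open>equivalence_map_is_shear\<close>).  Conversely every even \<open>z\<close> gives a shear, which is even and bijective.
  Comparing \<open>L\<^sup>*\<close>-components, the terms containing \<open>f\<close> and \<open>g\<close> cancel, and the shear respects the
  brackets exactly when the two cocycles differ by the coboundary of \<open>z\<close>, and the twists exactly when
  \<open>z\<close> intertwines \<open>\<alpha>\<close> with its transpose (\<open>equivalence_map_shear_iff\<close>).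

  The shear changes the form by \<open>q(\<phi>(u), \<phi>(v)) - q(u, v) = z(x)(y) + (-1)\<^bsup>|x||y|\<^esup> z(y)(x)\<close>, where
  \<open>x\<close> and \<open>y\<close> are the \<open>L\<close>-components of \<open>u\<close> and \<open>v\<close>.  That is twice the supersymmetric part of \<open>z\<close>,
  so in characteristic other than 2 the isometric shears are those for which this part vanishes
  (\<open>shear_isometry_iff\<close>).

  Invariance of the supersymmetric part expresses that the coboundary of \<open>z\<close>, being the difference of
  two supercyclic maps, is supercyclic: written out on homogeneous elements, the cyclicity relation is
  the invariance equation after one common term has cancelled
  (\<open>supersym_part_invariant_homogeneous\<close>).

  All sign rules are given on homogeneous elements, whereas morphisms, isometries and invariance speak
  of all elements.  The passage between the two rests on multilinearity: maps that are linear in each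
  argument and agree on homogeneous arguments agree everywhere.\<close>

section \<open>Super vector spaces and their linear and bilinear maps\<close>

lemma ksign_square [simp]: "ksign a * ksign a = (1 :: 'k::field)"
  by (simp add: ksign_def)

lemma space_of_subspace:
  assumes "super_vector_space V"
  shows "module.subspace (scal V) (space_of V)"
proof -
  interpret vector_space "scal V"
    using assms by (simp add: super_vector_space_def)
  have "space_of V = {u + v | u v. u \<in> part V 0 \<and> v \<in> part V 1}"
    by (simp add: space_of_def)
  then show ?thesis
    using assms subspace_sums[of "part V 0" "part V 1"]
    by (simp add: super_vector_space_def)
qed

lemma space_of_closed:
  assumes "super_vector_space V"
  shows space_of_zero: "0 \<in> space_of V"
    and space_of_add: "x \<in> space_of V \<Longrightarrow> y \<in> space_of V \<Longrightarrow> x + y \<in> space_of V"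
    and space_of_diff: "x \<in> space_of V \<Longrightarrow> y \<in> space_of V \<Longrightarrow> x - y \<in> space_of V"
    and space_of_scal: "x \<in> space_of V \<Longrightarrow> scal V c x \<in> space_of V"
proof -
  interpret vector_space "scal V"
    using assms by (simp add: super_vector_space_def)
  note sub = space_of_subspace[OF assms]
  show "0 \<in> space_of V" using sub by (rule subspace_0)
  show "x \<in> space_of V \<Longrightarrow> y \<in> space_of V \<Longrightarrow> x + y \<in> space_of V"
    using sub by (rule subspace_add)
  show "x \<in> space_of V \<Longrightarrow> y \<in> space_of V \<Longrightarrow> x - y \<in> space_of V"
    using sub by (rule subspace_diff)
  show "x \<in> space_of V \<Longrightarrow> scal V c x \<in> space_of V"
    using sub by (rule subspace_scale)
qed

lemma part_closed:
  assumes "super_vector_space V"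
  shows part_zero: "0 \<in> part V d"
    and part_add: "x \<in> part V d \<Longrightarrow> y \<in> part V d \<Longrightarrow> x + y \<in> part V d"
    and part_diff: "x \<in> part V d \<Longrightarrow> y \<in> part V d \<Longrightarrow> x - y \<in> part V d"
    and part_scal: "x \<in> part V d \<Longrightarrow> scal V c x \<in> part V d"
proof -
  interpret vector_space "scal V"
    using assms by (simp add: super_vector_space_def)
  have sub: "subspace (part V d)"
    using assms by (simp add: super_vector_space_def)
  show "0 \<in> part V d" using sub by (rule subspace_0)
  show "x \<in> part V d \<Longrightarrow> y \<in> part V d \<Longrightarrow> x + y \<in> part V d"
    using sub by (rule subspace_add)
  show "x \<in> part V d \<Longrightarrow> y \<in> part V d \<Longrightarrow> x - y \<in> part V d"
    using sub by (rule subspace_diff)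
  show "x \<in> part V d \<Longrightarrow> scal V c x \<in> part V d"
    using sub by (rule subspace_scale)
qed

lemma part_in_space_of:
  assumes "super_vector_space V" and "x \<in> part V d"
  shows "x \<in> space_of V"
proof (cases d)
  case zero
  then have "x = x + 0 \<and> x \<in> part V 0 \<and> 0 \<in> part V 1"
    using assms part_zero by auto
  then show ?thesis unfolding space_of_def by blast
next
  case one
  then have "x = 0 + x \<and> 0 \<in> part V 0 \<and> x \<in> part V 1"
    using assms part_zero by auto
  then show ?thesis unfolding space_of_def by blast
qed

lemma scal_laws:
  assumes "super_vector_space V"
  shows scal_add_right: "scal V c (x + y) = scal V c x + scal V c y"
    and scal_diff_right: "scal V c (x - y) = scal V c x - scal V c y"
    and scal_zero_right: "scal V c 0 = 0"
    and scal_minus_one: "scal V (- 1) x = - x"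
    and scal_scal: "scal V c (scal V d x) = scal V (c * d) x"
proof -
  interpret vector_space "scal V"
    using assms by (simp add: super_vector_space_def)
  show "scal V c (x + y) = scal V c x + scal V c y" by (rule scale_right_distrib)
  show "scal V c (x - y) = scal V c x - scal V c y" by (rule scale_right_diff_distrib)
  show "scal V c 0 = 0" by (rule scale_zero_right)
  show "scal V (- 1) x = - x" by simp
  show "scal V c (scal V d x) = scal V (c * d) x" by simp
qed

subsection \<open>Homogeneous components\<close>

lemma hcomp_eqI:
  assumes V: "super_vector_space V" and u: "u \<in> part V d" and v: "x - u \<in> part V (d + 1)"
  shows "hcomp V d x = u"
  unfolding hcomp_def
proof (rule the_equality)
  show "u \<in> part V d \<and> x - u \<in> part V (d + 1)" using u v by blast
next
  fix w assume w: "w \<in> part V d \<and> x - w \<in> part V (d + 1)"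
  have "w - u \<in> part V d" using w u part_diff[OF V] by blast
  moreover have "(x - u) - (x - w) \<in> part V (d + 1)" using w v part_diff[OF V] by blast
  ultimately have "w - u \<in> part V 0 \<inter> part V 1" by (cases d) auto
  then have "w - u = 0" using V unfolding super_vector_space_def by blast
  then show "w = u" by simp
qed

lemma hcomp_homogeneous:
  assumes "super_vector_space V" and "x \<in> part V d"
  shows "hcomp V e x = (if e = d then x else 0)"
proof (cases "e = d")
  case True
  then show ?thesis using hcomp_eqI[of V x d x] assms part_zero by auto
next
  case False
  then have "e + 1 = d" by (cases e; cases d) auto
  then show ?thesis using hcomp_eqI[of V 0 e x] assms part_zero False by auto
qed

lemma space_of_cases:
  assumes "x \<in> space_of V"
  obtains u v where "x = u + v" "u \<in> part V d" "v \<in> part V (d + 1)"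
proof -
  obtain u v where "x = u + v" "u \<in> part V 0" "v \<in> part V 1"
    using assms unfolding space_of_def by blast
  then show thesis using that[of u v] that[of v u] by (cases d) (auto simp: add.commute)
qed

lemma hcomp_sum_homogeneous:
  assumes "super_vector_space V" and "u \<in> part V d" and "v \<in> part V (d + 1)"
  shows "hcomp V d (u + v) = u"
  by (rule hcomp_eqI) (use assms in auto)

lemma hcomp_in_part:
  assumes "super_vector_space V" and "x \<in> space_of V"
  shows "hcomp V d x \<in> part V d"
  using assms by (metis space_of_cases hcomp_sum_homogeneous)

lemma hcomp_decomposition:
  assumes V: "super_vector_space V" and x: "x \<in> space_of V"
  shows "x = hcomp V 0 x + hcomp V 1 x"
proof -
  obtain u v where *: "x = u + v" "u \<in> part V 0" "v \<in> part V (0 + 1)"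
    using x by (rule space_of_cases)
  then have "hcomp V 0 (u + v) = u" "hcomp V 1 (v + u) = v"
    using hcomp_sum_homogeneous[OF V, of u 0 v] hcomp_sum_homogeneous[OF V, of v 1 u] by auto
  then show ?thesis using * by (simp add: add.commute)
qed

lemma linear_map_hcomp:
  assumes V: "super_vector_space V"
  shows "linear_map V V (hcomp V d)"
  unfolding linear_map_def
proof (intro conjI ballI allI)
  fix x assume "x \<in> space_of V"
  then show "hcomp V d x \<in> space_of V"
    using hcomp_in_part part_in_space_of V by blast
next
  fix x y assume "x \<in> space_of V" "y \<in> space_of V"
  then obtain u v u' v' where *: "x = u + v" "u \<in> part V d" "v \<in> part V (d + 1)"
    "y = u' + v'" "u' \<in> part V d" "v' \<in> part V (d + 1)"
    by (metis space_of_cases)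
  then have "hcomp V d (x + y) = u + u'"
    by (intro hcomp_eqI[OF V]) (auto intro!: part_add[OF V] simp: algebra_simps)
  then show "hcomp V d (x + y) = hcomp V d x + hcomp V d y"
    using * hcomp_sum_homogeneous[OF V] by simp
next
  fix c x assume "x \<in> space_of V"
  then obtain u v where *: "x = u + v" "u \<in> part V d" "v \<in> part V (d + 1)"
    by (metis space_of_cases)
  then have "hcomp V d (scal V c x) = scal V c u"
    by (intro hcomp_eqI[OF V]) (auto intro!: part_scal[OF V] simp: scal_add_right[OF V])
  then show "hcomp V d (scal V c x) = scal V c (hcomp V d x)"
    using * hcomp_sum_homogeneous[OF V] by simp
qed

subsection \<open>Linear maps\<close>

lemma linear_map_apply:
  assumes "linear_map V W f"
  shows linear_map_in: "x \<in> space_of V \<Longrightarrow> f x \<in> space_of W"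
    and linear_map_add: "x \<in> space_of V \<Longrightarrow> y \<in> space_of V \<Longrightarrow> f (x + y) = f x + f y"
    and linear_map_scal: "x \<in> space_of V \<Longrightarrow> f (scal V c x) = scal W c (f x)"
  using assms by (auto simp: linear_map_def)

lemma linear_map_zero:
  assumes "super_vector_space V" "linear_map V W f"
  shows "f 0 = 0"
  using linear_map_add[OF assms(2), of 0 0] space_of_zero[OF assms(1)] by simp

lemma linear_map_minus:
  assumes "super_vector_space V" "super_vector_space W" "linear_map V W f" "x \<in> space_of V"
  shows "f (- x) = - f x"
  using linear_map_scal[OF assms(3,4), of "- 1"] assms by (simp add: scal_minus_one)

lemma linear_map_comp:
  assumes "linear_map U V f" "linear_map V W g"
  shows "linear_map U W (\<lambda>x. g (f x))"
  using assms by (auto simp: linear_map_def)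

lemma linear_map_combine:
  assumes "super_vector_space W" "linear_map V W f" "linear_map V W g"
  shows linear_map_plus: "linear_map V W (\<lambda>x. f x + g x)"
    and linear_map_difference: "linear_map V W (\<lambda>x. f x - g x)"
  using assms
  by (auto simp: linear_map_def scal_laws intro: space_of_add space_of_diff)

lemma linear_map_scale:
  assumes "super_vector_space W" "linear_map V W f"
  shows "linear_map V W (\<lambda>x. scal W c (f x))"
  using assms by (auto simp: linear_map_def scal_laws mult.commute intro: space_of_scal)

lemma even_linear_map_hcomp:
  assumes V: "super_vector_space V" and W: "super_vector_space W"
    and f: "even_linear_map V W f" and x: "x \<in> space_of V"
  shows "hcomp W d (f x) = f (hcomp V d x)"
proof -
  obtain u v where *: "x = u + v" "u \<in> part V d" "v \<in> part V (d + 1)"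
    using x by (rule space_of_cases)
  have "f x = f u + f v"
    using * f V linear_map_add part_in_space_of unfolding even_linear_map_def by metis
  moreover have "f u \<in> part W d" "f v \<in> part W (d + 1)"
    using * f by (auto simp: even_linear_map_def)
  ultimately show ?thesis
    using * hcomp_sum_homogeneous[OF V] hcomp_sum_homogeneous[OF W] by simp
qed

lemma linear_map_eqI_homogeneous:
  assumes V: "super_vector_space V" and f: "linear_map V W f" and g: "linear_map V W g"
    and eq: "\<And>d x. x \<in> part V d \<Longrightarrow> f x = g x" and x: "x \<in> space_of V"
  shows "f x = g x"
proof -
  obtain u v where *: "x = u + v" "u \<in> part V 0" "v \<in> part V (0 + 1)"
    using x by (rule space_of_cases)
  then have "u \<in> space_of V" "v \<in> space_of V" using part_in_space_of[OF V] by blast+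
  then show ?thesis using * eq linear_map_add[OF f] linear_map_add[OF g] by metis
qed

subsection \<open>Bilinear maps\<close>

lemma bilinear_map_in:
  assumes "bilinear_map V W U B" "x \<in> space_of V" "y \<in> space_of W"
  shows "B x y \<in> space_of U"
  using assms by (auto simp: bilinear_map_def linear_map_def)

lemma bilinear_map_linear:
  assumes "bilinear_map V W U B"
  shows bilinear_map_linear_right: "x \<in> space_of V \<Longrightarrow> linear_map W U (B x)"
    and bilinear_map_linear_left: "y \<in> space_of W \<Longrightarrow> linear_map V U (\<lambda>x. B x y)"
  using assms by (auto simp: bilinear_map_def)

lemma bilinear_map_flip:
  assumes "bilinear_map V W U B"
  shows "bilinear_map W V U (\<lambda>y x. B x y)"
  using assms by (auto simp: bilinear_map_def)

lemma bilinear_map_comp_args: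
  assumes "bilinear_map V W U B" "linear_map V' V f" "linear_map W' W g"
  shows "bilinear_map V' W' U (\<lambda>x y. B (f x) (g y))"
  unfolding bilinear_map_def
proof (intro conjI ballI)
  fix x assume "x \<in> space_of V'"
  then show "linear_map W' U (\<lambda>y. B (f x) (g y))"
    by (intro linear_map_comp[OF assms(3)] bilinear_map_linear_right[OF assms(1)]
        linear_map_in[OF assms(2)])
next
  fix y assume "y \<in> space_of W'"
  then have "linear_map V U (\<lambda>x. B x (g y))"
    by (intro bilinear_map_linear_left[OF assms(1)] linear_map_in[OF assms(3)])
  then show "linear_map V' U (\<lambda>x. B (f x) (g y))"
    by (rule linear_map_comp[OF assms(2)])
qed

lemma bilinear_map_comp_value:
  assumes "bilinear_map V W U B" "linear_map U U' h"
  shows "bilinear_map V W U' (\<lambda>x y. h (B x y))"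
  unfolding bilinear_map_def
proof (intro conjI ballI)
  fix x assume "x \<in> space_of V"
  then show "linear_map W U' (\<lambda>y. h (B x y))"
    by (rule linear_map_comp[OF bilinear_map_linear_right[OF assms(1)] assms(2)])
next
  fix y assume "y \<in> space_of W"
  then show "linear_map V U' (\<lambda>x. h (B x y))"
    by (rule linear_map_comp[OF bilinear_map_linear_left[OF assms(1)] assms(2)])
qed

lemma bilinear_map_combine:
  assumes "super_vector_space U" "bilinear_map V W U B" "bilinear_map V W U C"
  shows bilinear_map_plus: "bilinear_map V W U (\<lambda>x y. B x y + C x y)"
    and bilinear_map_difference: "bilinear_map V W U (\<lambda>x y. B x y - C x y)"
  unfolding bilinear_map_def
  by (intro conjI ballI linear_map_combine[OF assms(1)] bilinear_map_linear_right[OF assms(2)]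
      bilinear_map_linear_right[OF assms(3)] bilinear_map_linear_left[OF assms(2)]
      bilinear_map_linear_left[OF assms(3)]; assumption)+

lemma bilinear_map_scale:
  assumes "super_vector_space U" "bilinear_map V W U B"
  shows "bilinear_map V W U (\<lambda>x y. scal U c (B x y))"
  unfolding bilinear_map_def
  by (intro conjI ballI linear_map_scale[OF assms(1)] bilinear_map_linear_right[OF assms(2)]
      bilinear_map_linear_left[OF assms(2)])

lemma bilinear_map_eqI_homogeneous:
  assumes V: "super_vector_space V" and W: "super_vector_space W"
    and B: "bilinear_map V W U B" and C: "bilinear_map V W U C"
    and eq: "\<And>a b x y. x \<in> part V a \<Longrightarrow> y \<in> part W b \<Longrightarrow> B x y = C x y"
    and xy: "x \<in> space_of V" "y \<in> space_of W"
  shows "B x y = C x y"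
proof -
  have hom: "B x' y = C x' y" if x': "x' \<in> part V a" for x' a
  proof (rule linear_map_eqI_homogeneous[OF W _ _ _ xy(2)])
    show "linear_map W U (B x')" "linear_map W U (C x')"
      using part_in_space_of[OF V x'] bilinear_map_linear_right[OF B]
        bilinear_map_linear_right[OF C] by blast+
  qed (rule eq[OF x'])
  show ?thesis
  proof (rule linear_map_eqI_homogeneous[OF V _ _ _ xy(1)])
    show "linear_map V U (\<lambda>x. B x y)" "linear_map V U (\<lambda>x. C x y)"
      by (rule bilinear_map_linear_left[OF B xy(2)], rule bilinear_map_linear_left[OF C xy(2)])
  qed (rule hom)
qed

lemma signed_expand:
  "signed s V W B x y =
     s (ksign 0) (B (hcomp V 0 x) (hcomp W 0 y)) + s (ksign 0) (B (hcomp V 0 x) (hcomp W 1 y)) +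
     (s (ksign 0) (B (hcomp V 1 x) (hcomp W 0 y)) + s (ksign 1) (B (hcomp V 1 x) (hcomp W 1 y)))"
  by (simp add: signed_def)

text \<open>The sign-twisted map is a linear combination of the four maps obtained by composing \<open>B\<close> with
  projections to homogeneous components, and these projections are linear.\<close>

lemma bilinear_map_signed:
  assumes V: "super_vector_space V" and W: "super_vector_space W" and U: "super_vector_space U"
    and B: "bilinear_map V W U B"
  shows "bilinear_map V W U (signed (scal U) V W B)"
  unfolding signed_expand[abs_def]
  by (intro bilinear_map_plus[OF U] bilinear_map_scale[OF U] bilinear_map_comp_args[OF B]
      linear_map_hcomp V W)

lemma signed_homogeneous:
  assumes V: "super_vector_space V" and W: "super_vector_space W" and U: "super_vector_space U"
    and B: "bilinear_map V W U B" and x: "x \<in> part V a" and y: "y \<in> part W b"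
  shows "signed (scal U) V W B x y = scal U (ksign (a * b)) (B x y)"
proof -
  note xs = part_in_space_of[OF V x] and ys = part_in_space_of[OF W y]
  have "B x 0 = 0" "B 0 y = 0"
    using linear_map_zero[OF W bilinear_map_linear_right[OF B xs]]
      linear_map_zero[OF V bilinear_map_linear_left[OF B ys]] by auto
  moreover have "B 0 0 = 0"
    using linear_map_zero[OF W bilinear_map_linear_right[OF B space_of_zero[OF V]]] .
  ultimately show ?thesis
    by (cases a; cases b)
      (simp_all add: signed_expand hcomp_homogeneous[OF V x] hcomp_homogeneous[OF W y]
        scal_zero_right[OF U])
qed

section \<open>The ground field and the dual space\<close>

lemma scal_ground [simp]: "scal ground = (*)"
  by (simp add: ground_def)

lemma space_of_ground [simp]: "space_of ground = UNIV"
  by (auto simp: space_of_def ground_def)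

lemma super_vector_space_ground: "super_vector_space (ground :: ('k::field, 'k) super_space)"
proof -
  interpret vector_space "(*) :: 'k \<Rightarrow> 'k \<Rightarrow> 'k"
    by unfold_locales (auto simp: algebra_simps)
  show ?thesis
    unfolding super_vector_space_def
    by (auto simp: ground_def subspace_def intro: vector_space_axioms)
qed

lemma scal_dual [simp]: "scal (dual V) c f y = c * f y"
  by (simp add: dual_def)

lemma in_part_dual:
  "f \<in> part (dual V) d \<longleftrightarrow>
     linear_map V ground f \<and> (\<forall>y. y \<notin> space_of V \<longrightarrow> f y = 0) \<and>
     (\<forall>e. e \<noteq> d \<longrightarrow> (\<forall>y\<in>part V e. f y = 0))"
  by (simp add: dual_def)

lemma super_vector_space_dual:
  fixes V :: "('k::field, 'v::ab_group_add, 'm) super_space_scheme"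
  assumes V: "super_vector_space V"
  shows "super_vector_space (dual V)"
proof -
  interpret vector_space "scal (dual V)"
    by unfold_locales (auto simp: fun_eq_iff algebra_simps)
  have "subspace (part (dual V) d)" for d
    by (auto simp: subspace_def in_part_dual linear_map_def algebra_simps)
  moreover have "f = 0" if f: "f \<in> part (dual V) 0" "f \<in> part (dual V) 1" for f
  proof
    fix y
    have lin: "linear_map V ground f" and out: "y \<notin> space_of V \<Longrightarrow> f y = 0"
      using f by (auto simp: in_part_dual)
    have hom: "f u = 0" if "u \<in> part V d" for u d
      using f that by (cases d) (auto simp: in_part_dual)
    have "f y = 0" if y: "y \<in> space_of V"
    proof -
      obtain u v where *: "y = u + v" "u \<in> part V 0" "v \<in> part V (0 + 1)"
        using y by (rule space_of_cases)
      then have "f y = f u + f v" using linear_map_add[OF lin] part_in_space_of[OF V] by blast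
      then show ?thesis using hom * by simp
    qed
    with out show "f y = 0 y" by auto
  qed
  ultimately show ?thesis
    unfolding super_vector_space_def
    by (auto simp: subspace_0 intro: vector_space_axioms)
qed

text \<open>A functional is the sum of its restrictions to the two homogeneous components, so the graded
  dual contains every functional.\<close>

lemma in_space_of_dual:
  assumes V: "super_vector_space V"
  shows "f \<in> space_of (dual V) \<longleftrightarrow> linear_map V ground f \<and> (\<forall>y. y \<notin> space_of V \<longrightarrow> f y = 0)"
proof
  assume "f \<in> space_of (dual V)"
  then obtain g h where "f = g + h" "g \<in> part (dual V) 0" "h \<in> part (dual V) 1"
    unfolding space_of_def by blast
  then show "linear_map V ground f \<and> (\<forall>y. y \<notin> space_of V \<longrightarrow> f y = 0)"
    by (auto simp: in_part_dual linear_map_def algebra_simps)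
next
  assume f: "linear_map V ground f \<and> (\<forall>y. y \<notin> space_of V \<longrightarrow> f y = 0)"
  define g where "g d = (\<lambda>y. if y \<in> space_of V then f (hcomp V d y) else 0)" for d
  have "linear_map V ground (\<lambda>y. f (hcomp V d y))" for d
    using f linear_map_comp linear_map_hcomp[OF V] by blast
  then have "linear_map V ground (g d)" for d
    by (auto simp: linear_map_def g_def space_of_add[OF V] space_of_scal[OF V])
  then have part: "g d \<in> part (dual V) d" for d
    using f linear_map_zero[OF V] by (auto simp: in_part_dual g_def hcomp_homogeneous[OF V])
  have "f y = g 0 y + g 1 y" for y
  proof (cases "y \<in> space_of V")
    case True
    have "f y = f (hcomp V 0 y + hcomp V 1 y)"
      using hcomp_decomposition[OF V True] by simp
    then show ?thesis
      using True f linear_map_add linear_map_in[OF linear_map_hcomp[OF V] True]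
      by (simp add: g_def linear_map_def)
  qed (use f in \<open>auto simp: g_def\<close>)
  then have "f = g 0 + g 1" by auto
  then show "f \<in> space_of (dual V)" unfolding space_of_def using part by blast
qed

lemma bilinear_map_evaluation:
  assumes V: "super_vector_space V"
  shows "bilinear_map V (dual V) ground (\<lambda>x f. f x)"
  by (auto simp: bilinear_map_def in_space_of_dual[OF V]) (simp add: linear_map_def)

lemma bilinear_map_of_linear_to_dual:
  assumes V: "super_vector_space V" and z: "linear_map W (dual V) z"
  shows "bilinear_map W V ground z"
proof -
  have "linear_map V ground (z x)" if "x \<in> space_of W" for x
    using linear_map_in[OF z that] in_space_of_dual[OF V] by blast
  moreover have "linear_map W ground (\<lambda>x. z x y)" for y
    using z by (auto simp: linear_map_def)
  ultimately show ?thesis by (auto simp: bilinear_map_def)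
qed

section \<open>The coadjoint action\<close>

lemma hom_lie_superalgebra_space:
  "hom_lie_superalgebra L \<Longrightarrow> super_vector_space L"
  by (simp add: hom_lie_superalgebra_def)

lemma hom_lie_superalgebra_brk:
  assumes "hom_lie_superalgebra L"
  shows "bilinear_map L L L (brk L)"
    and "x \<in> part L a \<Longrightarrow> y \<in> part L b \<Longrightarrow> brk L x y \<in> part L (a + b)"
  using assms unfolding hom_lie_superalgebra_def even_bilinear_map_def by blast+

lemma hom_lie_superalgebra_twist:
  "hom_lie_superalgebra L \<Longrightarrow> linear_map L L (twist L)"
  unfolding hom_lie_superalgebra_def even_linear_map_def by blast

text \<open>Precomposition with \<open>ad(x)\<close>; \<^const>\<open>coadj\<close> is its signed version, negated.\<close>

lemma bilinear_map_precompose_bracket: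
  assumes L: "hom_lie_superalgebra L"
  shows "bilinear_map L (dual L) (dual L) (\<lambda>x f y. if y \<in> space_of L then f (brk L x y) else 0)"
proof -
  note V = hom_lie_superalgebra_space[OF L] and B = hom_lie_superalgebra_brk(1)[OF L]
  let ?P = "\<lambda>x f y. if y \<in> space_of L then f (brk L x y) else 0"
  have mem: "?P x f \<in> space_of (dual L)" if "x \<in> space_of L" "f \<in> space_of (dual L)" for x f
  proof -
    have "linear_map L ground (\<lambda>y. f (brk L x y))"
      by (rule linear_map_comp[OF bilinear_map_linear_right[OF B that(1)]])
        (use that(2) in \<open>simp add: in_space_of_dual[OF V]\<close>)
    then show ?thesis
      unfolding in_space_of_dual[OF V]
      by (auto simp: linear_map_def space_of_add[OF V] space_of_scal[OF V])
  qed
  have "linear_map L ground (\<lambda>x. f (brk L x y))"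
    if "y \<in> space_of L" "f \<in> space_of (dual L)" for y f
    by (rule linear_map_comp[OF bilinear_map_linear_left[OF B that(1)]])
      (use that(2) in \<open>simp add: in_space_of_dual[OF V]\<close>)
  then show ?thesis
    using mem by (auto simp: bilinear_map_def linear_map_def fun_eq_iff)
qed

lemma bilinear_map_coadj:
  assumes L: "hom_lie_superalgebra L"
  shows "bilinear_map L (dual L) (dual L) (coadj L)"
proof -
  note V = hom_lie_superalgebra_space[OF L]
  note D = super_vector_space_dual[OF V]
  have "coadj L x f = scal (dual L) (- 1) (signed (scal (dual L)) L (dual L)
         (\<lambda>x f y. if y \<in> space_of L then f (brk L x y) else 0) x f)" for x f
    by (simp add: coadj_def scal_minus_one[OF D])
  then have "coadj L = (\<lambda>x f. scal (dual L) (- 1) (signed (scal (dual L)) L (dual L)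
         (\<lambda>x f y. if y \<in> space_of L then f (brk L x y) else 0) x f))"
    by blast
  then show ?thesis
    using bilinear_map_scale[OF D bilinear_map_signed[OF V D D
          bilinear_map_precompose_bracket[OF L]]] by simp
qed

lemma coadj_homogeneous:
  assumes L: "hom_lie_superalgebra L" and "x \<in> part L a" "f \<in> part (dual L) b" "y \<in> space_of L"
  shows "coadj L x f y = - (ksign (a * b) * f (brk L x y))"
proof -
  note V = hom_lie_superalgebra_space[OF L]
  note D = super_vector_space_dual[OF V]
  show ?thesis
    using assms signed_homogeneous[OF V D D bilinear_map_precompose_bracket[OF L] assms(2,3)]
    by (simp add: coadj_def)
qed

lemma bilinear_map_signed_coadj:
  assumes L: "hom_lie_superalgebra L"
  shows "bilinear_map L (dual L) (dual L) (signed (scal (dual L)) L (dual L) (coadj L))"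
  using bilinear_map_signed bilinear_map_coadj[OF L] super_vector_space_dual
    hom_lie_superalgebra_space[OF L] by blast

section \<open>Equivalences of extensions are shears\<close>

definition shear :: "('v \<Rightarrow> 'v \<Rightarrow> 'k) \<Rightarrow> 'v \<times> ('v \<Rightarrow> 'k) \<Rightarrow> 'v \<times> ('v \<Rightarrow> 'k::ab_group_add)" where
  "shear z = (\<lambda>(x, f). (x, z x + f))"

lemma Tstar_simps [simp]:
  "scal (Tstar L \<omega>) c (x, f) = (scal L c x, scal (dual L) c f)"
  "part (Tstar L \<omega>) d = part L d \<times> part (dual L) d"
  "brk (Tstar L \<omega>) (x, f) (y, g) =
     (brk L x y, \<omega> x y + coadj L x g - signed (scal (dual L)) L (dual L) (coadj L) y f)"
  "twist (Tstar L \<omega>) (x, f) = (twist L x, dual_twist L f)"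
  by (simp_all add: Tstar_def)

lemma space_of_Tstar [simp]: "space_of (Tstar L \<omega>) = space_of L \<times> space_of (dual L)"
proof -
  have "(a, b) \<in> space_of (Tstar L \<omega>) \<longleftrightarrow> a \<in> space_of L \<and> b \<in> space_of (dual L)" for a b
    unfolding space_of_def by (simp add: Bex_def split_paired_Ex) blast
  then show ?thesis by auto
qed

lemma dual_twist_linear:
  assumes L: "hom_lie_superalgebra L"
  shows "linear_map (dual L) (dual L) (dual_twist L)"
proof -
  note V = hom_lie_superalgebra_space[OF L]
  note tw = hom_lie_superalgebra_twist[OF L]
  have "dual_twist L f \<in> space_of (dual L)" if "f \<in> space_of (dual L)" for f
  proof -
    have "linear_map L ground (\<lambda>y. f (twist L y))"
      by (rule linear_map_comp[OF tw]) (use that in \<open>simp add: in_space_of_dual[OF V]\<close>)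
    then show ?thesis
      unfolding in_space_of_dual[OF V] dual_twist_def
      by (auto simp: linear_map_def space_of_add[OF V] space_of_scal[OF V])
  qed
  then show ?thesis
    by (auto simp: linear_map_def dual_twist_def fun_eq_iff)
qed

lemma Tstar_brk_closed:
  assumes L: "hom_lie_superalgebra L" and \<omega>: "bilinear_map L L (dual L) \<omega>"
    and "u \<in> space_of (Tstar L \<omega>)" "v \<in> space_of (Tstar L \<omega>)"
  shows "brk (Tstar L \<omega>) u v \<in> space_of (Tstar L \<omega>)"
proof -
  note D = super_vector_space_dual[OF hom_lie_superalgebra_space[OF L]]
  show ?thesis
    using assms(3,4) bilinear_map_in[OF hom_lie_superalgebra_brk(1)[OF L]] bilinear_map_in[OF \<omega>]
      bilinear_map_in[OF bilinear_map_coadj[OF L]] bilinear_map_in[OF bilinear_map_signed_coadj[OF L]]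
    by (auto intro!: space_of_add[OF D] space_of_diff[OF D])
qed

lemma Tstar_twist_closed:
  assumes L: "hom_lie_superalgebra L" and "u \<in> space_of (Tstar L \<omega>)"
  shows "twist (Tstar L \<omega>) u \<in> space_of (Tstar L \<omega>)"
  using assms linear_map_in[OF dual_twist_linear[OF L]]
    linear_map_in[OF hom_lie_superalgebra_twist[OF L]]
  by auto

lemma super_vector_space_Tstar:
  assumes V: "super_vector_space L"
  shows "super_vector_space (Tstar L \<omega>)"
proof -
  note D = super_vector_space_dual[OF V]
  interpret L: vector_space "scal L" using V by (simp add: super_vector_space_def)
  interpret D: vector_space "scal (dual L)" using D by (simp add: super_vector_space_def)
  interpret T: vector_space "scal (Tstar L \<omega>)"
    by unfold_locales
      (auto simp: L.scale_right_distrib L.scale_left_distrib D.scale_right_distrib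
        D.scale_left_distrib)
  have "T.subspace (part (Tstar L \<omega>) d)" for d
    by (auto simp: T.subspace_def zero_prod_def intro: part_closed[OF V] part_closed[OF D])
  then show ?thesis
    using V D unfolding super_vector_space_def
    by (auto simp: zero_prod_def T.vector_space_axioms)
qed

text \<open>An equivalence constrains its values only on the extension.  The conditions also
  evaluate it at sums, brackets and twists, so transferring them to another map uses that the
  extension is closed under these operations.\<close>

lemma equivalence_map_cong:
  assumes L: "hom_lie_superalgebra L" and \<omega>: "bilinear_map L L (dual L) \<omega>\<^sub>1"
    and eq: "\<And>u. u \<in> space_of (Tstar L \<omega>\<^sub>1) \<Longrightarrow> \<phi> u = \<psi> u"
    and \<phi>: "equivalence_map L \<omega>\<^sub>1 \<omega>\<^sub>2 \<phi>"
  shows "equivalence_map L \<omega>\<^sub>1 \<omega>\<^sub>2 \<psi>"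
proof -
  note V = hom_lie_superalgebra_space[OF L]
  note T = super_vector_space_Tstar[OF V, of \<omega>\<^sub>1]
  have closed: "u + v \<in> space_of (Tstar L \<omega>\<^sub>1)" "scal (Tstar L \<omega>\<^sub>1) c u \<in> space_of (Tstar L \<omega>\<^sub>1)"
    "brk (Tstar L \<omega>\<^sub>1) u v \<in> space_of (Tstar L \<omega>\<^sub>1)" "twist (Tstar L \<omega>\<^sub>1) u \<in> space_of (Tstar L \<omega>\<^sub>1)"
    if "u \<in> space_of (Tstar L \<omega>\<^sub>1)" "v \<in> space_of (Tstar L \<omega>\<^sub>1)" for u v c
    using that by (auto intro: space_of_add[OF T] space_of_scal[OF T] Tstar_brk_closed[OF L \<omega>]
        Tstar_twist_closed[OF L] simp del: space_of_Tstar)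
  have "linear_map (Tstar L \<omega>\<^sub>1) (Tstar L \<omega>\<^sub>2) \<psi>"
    using \<phi> eq closed
    by (simp add: equivalence_map_def hom_isomorphism_def hom_morphism_def even_linear_map_def
        linear_map_def del: space_of_Tstar)
  moreover have "\<psi> u \<in> part (Tstar L \<omega>\<^sub>2) d" if "u \<in> part (Tstar L \<omega>\<^sub>1) d" for u d
  proof -
    have "\<phi> u \<in> part (Tstar L \<omega>\<^sub>2) d"
      using that \<phi> unfolding equivalence_map_def hom_isomorphism_def hom_morphism_def
        even_linear_map_def by blast
    then show ?thesis using eq[OF part_in_space_of[OF T that]] by metis
  qed
  ultimately have "even_linear_map (Tstar L \<omega>\<^sub>1) (Tstar L \<omega>\<^sub>2) \<psi>"
    by (simp add: even_linear_map_def del: space_of_Tstar Tstar_simps)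
  then have "hom_morphism (Tstar L \<omega>\<^sub>1) (Tstar L \<omega>\<^sub>2) \<psi>"
    using \<phi> eq closed
    by (simp add: equivalence_map_def hom_isomorphism_def hom_morphism_def del: space_of_Tstar)
  moreover have "bij_betw \<psi> (space_of (Tstar L \<omega>\<^sub>1)) (space_of (Tstar L \<omega>\<^sub>2))"
    using \<phi> bij_betw_cong[of "space_of (Tstar L \<omega>\<^sub>1)" \<phi> \<psi>] eq
    by (simp add: equivalence_map_def hom_isomorphism_def del: space_of_Tstar)
  ultimately show ?thesis
    using \<phi> eq space_of_zero[OF V] unfolding equivalence_map_def hom_isomorphism_def by auto
qed

text \<open>Since \<open>x + f\<close> is the sum of \<open>x\<close> and \<open>f\<close> and the map fixes \<open>f\<close>, it is determined by its values on
  \<open>L\<close>; these have \<open>L\<close>-component \<open>x\<close>, because the map induces the identity on the quotient.\<close>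

lemma equivalence_map_is_shear:
  assumes L: "hom_lie_superalgebra L" and \<phi>: "equivalence_map L \<omega>\<^sub>1 \<omega>\<^sub>2 \<phi>"
  obtains z where "z \<in> even_cochain1 L" "\<And>u. u \<in> space_of (Tstar L \<omega>\<^sub>1) \<Longrightarrow> \<phi> u = shear z u"
proof
  note V = hom_lie_superalgebra_space[OF L]
  note D = super_vector_space_dual[OF V]
  define z where "z x = snd (\<phi> (x, 0))" for x
  have even: "even_linear_map (Tstar L \<omega>\<^sub>1) (Tstar L \<omega>\<^sub>2) \<phi>"
    and fix_dual: "\<And>f. f \<in> space_of (dual L) \<Longrightarrow> \<phi> (0, f) = (0, f)"
    and over_L: "\<And>x f. x \<in> space_of L \<Longrightarrow> f \<in> space_of (dual L) \<Longrightarrow> fst (\<phi> (x, f)) = x"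
    using \<phi> by (auto simp: equivalence_map_def hom_isomorphism_def hom_morphism_def)
  have lin: "linear_map (Tstar L \<omega>\<^sub>1) (Tstar L \<omega>\<^sub>2) \<phi>" using even by (simp add: even_linear_map_def)
  have \<phi>_L: "\<phi> (x, 0) = (x, z x)" if "x \<in> space_of L" for x
    using over_L[OF that space_of_zero[OF D]] by (simp add: z_def prod_eq_iff)
  have split: "\<phi> ((x, f) + (y, g)) = \<phi> (x, f) + \<phi> (y, g)"
    if "x \<in> space_of L" "y \<in> space_of L" "f \<in> space_of (dual L)" "g \<in> space_of (dual L)" for x y f g
    using linear_map_add[OF lin, of "(x, f)" "(y, g)"] that by simp
  have "linear_map L (dual L) z"
    unfolding linear_map_def
  proof (intro conjI ballI allI)
    fix x assume x: "x \<in> space_of L"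
    show "z x \<in> space_of (dual L)"
      using linear_map_in[OF lin, of "(x, 0)"] x \<phi>_L[OF x] space_of_zero[OF D] by simp
    fix c
    show "z (scal L c x) = scal (dual L) c (z x)"
      using linear_map_scal[OF lin, of "(x, 0)" c] x \<phi>_L space_of_zero[OF D] space_of_scal[OF V x]
      by (simp add: scal_zero_right[OF D])
  next
    fix x y assume "x \<in> space_of L" "y \<in> space_of L"
    then show "z (x + y) = z x + z y"
      using split[of x y 0 0] \<phi>_L space_of_zero[OF D] space_of_add[OF V] by simp
  qed
  moreover have "z x \<in> part (dual L) d" if x: "x \<in> part L d" for x d
  proof -
    have "\<phi> (x, 0) \<in> part (Tstar L \<omega>\<^sub>2) d"
      using even x part_zero[OF D] by (simp add: even_linear_map_def)
    then show ?thesis using \<phi>_L[OF part_in_space_of[OF V x]] by simp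
  qed
  ultimately show "z \<in> even_cochain1 L" by (simp add: even_cochain1_def even_linear_map_def)
  show "\<phi> u = shear z u" if "u \<in> space_of (Tstar L \<omega>\<^sub>1)" for u
    using that split[of "fst u" 0 0 "snd u"] \<phi>_L fix_dual space_of_zero[OF D] space_of_zero[OF V]
    by (auto simp: shear_def)
qed

lemma even_cochain1_linear:
  assumes "z \<in> even_cochain1 L"
  shows "linear_map L (dual L) z" "x \<in> part L d \<Longrightarrow> z x \<in> part (dual L) d"
  using assms by (auto simp: even_cochain1_def even_linear_map_def)

text \<open>The two sides of the coboundary equation are bilinear, so it extends to all arguments once the
  sign is absorbed into \<^const>\<open>signed\<close>.\<close>

lemma differ_by_coboundary_iff:
  assumes L: "hom_lie_superalgebra L" and z: "z \<in> even_cochain1 L"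
    and \<omega>1: "bilinear_map L L (dual L) \<omega>\<^sub>1" and \<omega>2: "bilinear_map L L (dual L) \<omega>\<^sub>2"
  shows "differ_by_coboundary L \<omega>\<^sub>1 \<omega>\<^sub>2 z \<longleftrightarrow>
    (\<forall>x\<in>space_of L. \<forall>y\<in>space_of L. \<omega>\<^sub>1 x y - \<omega>\<^sub>2 x y =
      coadj L x (z y) - signed (scal (dual L)) L (dual L) (coadj L) y (z x) - z (brk L x y))"
    (is "_ \<longleftrightarrow> (\<forall>x\<in>_. \<forall>y\<in>_. ?lhs x y = ?rhs x y)")
proof -
  note V = hom_lie_superalgebra_space[OF L]
  note D = super_vector_space_dual[OF V]
  have id: "linear_map L L (\<lambda>x. x)" by (simp add: linear_map_def)
  note zl = even_cochain1_linear(1)[OF z]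
  have lhs: "bilinear_map L L (dual L) ?lhs"
    by (rule bilinear_map_difference[OF D \<omega>1 \<omega>2])
  have rhs: "bilinear_map L L (dual L) ?rhs"
    by (intro bilinear_map_difference[OF D] bilinear_map_comp_args[OF bilinear_map_coadj[OF L] id zl]
        bilinear_map_flip[OF bilinear_map_comp_args[OF bilinear_map_signed_coadj[OF L] id zl]]
        bilinear_map_comp_value[OF hom_lie_superalgebra_brk(1)[OF L] zl])
  have sign: "signed (scal (dual L)) L (dual L) (coadj L) y (z x) =
      scal (dual L) (ksign (a * b)) (coadj L y (z x))" if "x \<in> part L a" "y \<in> part L b" for x y a b
    using signed_homogeneous[OF V D D bilinear_map_coadj[OF L] that(2)
        even_cochain1_linear(2)[OF z that(1)]] by (simp add: mult.commute)
  show ?thesis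
  proof
    assume "differ_by_coboundary L \<omega>\<^sub>1 \<omega>\<^sub>2 z"
    then have "?lhs x y = ?rhs x y" if "x \<in> part L a" "y \<in> part L b" for x y a b
      using that sign[OF that] by (simp add: differ_by_coboundary_def)
    then show "\<forall>x\<in>space_of L. \<forall>y\<in>space_of L. ?lhs x y = ?rhs x y"
      using bilinear_map_eqI_homogeneous[OF V V lhs rhs] by blast
  next
    assume "\<forall>x\<in>space_of L. \<forall>y\<in>space_of L. ?lhs x y = ?rhs x y"
    then show "differ_by_coboundary L \<omega>\<^sub>1 \<omega>\<^sub>2 z"
      using part_in_space_of[OF V] sign unfolding differ_by_coboundary_def by metis
  qed
qed

lemma shear_respects_twist_iff:
  assumes L: "hom_lie_superalgebra L" and z: "z \<in> even_cochain1 L"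
  shows "(\<forall>u\<in>space_of (Tstar L \<omega>\<^sub>1). shear z (twist (Tstar L \<omega>\<^sub>1) u) = twist (Tstar L \<omega>\<^sub>2) (shear z u))
     \<longleftrightarrow> twist_compatible L z"
proof -
  note V = hom_lie_superalgebra_space[OF L]
  note D = super_vector_space_dual[OF V]
  have "dual_twist L (z x + f) = dual_twist L (z x) + dual_twist L f" for x f
    by (rule ext) (simp add: dual_twist_def)
  then show ?thesis
    using space_of_zero[OF D] by (auto simp: shear_def twist_compatible_def)
qed

text \<open>The \<open>L\<close>-components agree.  In the \<open>L\<^sup>*\<close>-components the terms in \<open>f\<close> and \<open>g\<close> are the same on both
  sides, because the coadjoint action is additive in the functional; what is left is the coboundary
  equation.\<close>

lemma shear_respects_brk_iff:
  assumes L: "hom_lie_superalgebra L" and z: "z \<in> even_cochain1 L"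
    and \<omega>1: "bilinear_map L L (dual L) \<omega>\<^sub>1" and \<omega>2: "bilinear_map L L (dual L) \<omega>\<^sub>2"
  shows "(\<forall>u\<in>space_of (Tstar L \<omega>\<^sub>1). \<forall>v\<in>space_of (Tstar L \<omega>\<^sub>1).
       shear z (brk (Tstar L \<omega>\<^sub>1) u v) = brk (Tstar L \<omega>\<^sub>2) (shear z u) (shear z v))
     \<longleftrightarrow> differ_by_coboundary L \<omega>\<^sub>1 \<omega>\<^sub>2 z"
proof -
  note V = hom_lie_superalgebra_space[OF L]
  note D = super_vector_space_dual[OF V]
  note zin = linear_map_in[OF even_cochain1_linear(1)[OF z]]
  let ?S = "signed (scal (dual L)) L (dual L) (coadj L)"
  have pair: "shear z (brk (Tstar L \<omega>\<^sub>1) (x, f) (y, g)) =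
        brk (Tstar L \<omega>\<^sub>2) (shear z (x, f)) (shear z (y, g)) \<longleftrightarrow>
      \<omega>\<^sub>1 x y - \<omega>\<^sub>2 x y = coadj L x (z y) - ?S y (z x) - z (brk L x y)"
    if "x \<in> space_of L" "y \<in> space_of L" "f \<in> space_of (dual L)" "g \<in> space_of (dual L)" for x y f g
  proof -
    have "coadj L x (z y + g) = coadj L x (z y) + coadj L x g"
      using that zin linear_map_add[OF bilinear_map_linear_right[OF bilinear_map_coadj[OF L]]] by blast
    moreover have "?S y (z x + f) = ?S y (z x) + ?S y f"
      using that zin linear_map_add[OF bilinear_map_linear_right[OF bilinear_map_signed_coadj[OF L]]]
      by blast
    ultimately show ?thesis by (auto simp: shear_def algebra_simps)
  qed
  show ?thesis
    unfolding differ_by_coboundary_iff[OF assms]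
  proof safe
    fix x y
    assume "\<forall>u\<in>space_of (Tstar L \<omega>\<^sub>1). \<forall>v\<in>space_of (Tstar L \<omega>\<^sub>1).
       shear z (brk (Tstar L \<omega>\<^sub>1) u v) = brk (Tstar L \<omega>\<^sub>2) (shear z u) (shear z v)"
      and "x \<in> space_of L" "y \<in> space_of L"
    then show "\<omega>\<^sub>1 x y - \<omega>\<^sub>2 x y = coadj L x (z y) - ?S y (z x) - z (brk L x y)"
      using pair[of x y 0 0] space_of_zero[OF D] by (simp del: Tstar_simps)
  qed (use pair in \<open>simp del: Tstar_simps\<close>)
qed

text \<open>A shear is invertible, with the shear by \<open>- z\<close> as inverse, so only compatibility with bracket
  and twist is at stake.\<close>

lemma equivalence_map_shear_iff:
  assumes L: "hom_lie_superalgebra L" and z: "z \<in> even_cochain1 L"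
    and \<omega>1: "bilinear_map L L (dual L) \<omega>\<^sub>1" and \<omega>2: "bilinear_map L L (dual L) \<omega>\<^sub>2"
  shows "equivalence_map L \<omega>\<^sub>1 \<omega>\<^sub>2 (shear z) \<longleftrightarrow>
    twist_compatible L z \<and> differ_by_coboundary L \<omega>\<^sub>1 \<omega>\<^sub>2 z"
proof -
  note V = hom_lie_superalgebra_space[OF L]
  note D = super_vector_space_dual[OF V]
  note zl = even_cochain1_linear(1)[OF z]
  note zin = linear_map_in[OF zl]
  have even: "even_linear_map (Tstar L \<omega>\<^sub>1) (Tstar L \<omega>\<^sub>2) (shear z)"
    using linear_map_add[OF zl] linear_map_scal[OF zl] zin even_cochain1_linear(2)[OF z]
    by (auto simp: even_linear_map_def linear_map_def shear_def scal_add_right[OF D] algebra_simps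
        intro: space_of_add[OF D] part_add[OF D])
  have bij: "bij_betw (shear z) (space_of (Tstar L \<omega>\<^sub>1)) (space_of (Tstar L \<omega>\<^sub>2))"
    by (rule bij_betw_byWitness[where f' = "\<lambda>(x, f). (x, f - z x)"])
      (use zin in \<open>auto simp: shear_def intro: space_of_add[OF D] space_of_diff[OF D]\<close>)
  show ?thesis
    using shear_respects_twist_iff[OF L z, of \<omega>\<^sub>1 \<omega>\<^sub>2] shear_respects_brk_iff[OF assms]
      linear_map_zero[OF V zl] even bij
    unfolding equivalence_map_def hom_isomorphism_def hom_morphism_def
    by (auto simp: shear_def simp del: space_of_Tstar Tstar_simps)
qed

section \<open>The supersymmetric part of the cochain\<close>

lemma bilinear_map_signed_flip:
  assumes V: "super_vector_space L" and z: "linear_map L (dual L) z"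
  shows "bilinear_map L L ground (signed (*) L L (\<lambda>x y. z y x))"
  using bilinear_map_signed[OF V V super_vector_space_ground
      bilinear_map_flip[OF bilinear_map_of_linear_to_dual[OF V z]]] by simp

lemma bilinear_map_supersym_part:
  assumes V: "super_vector_space L" and z: "linear_map L (dual L) z"
  shows "bilinear_map L L ground (supersym_part L z)"
  using bilinear_map_scale[OF super_vector_space_ground bilinear_map_plus[OF super_vector_space_ground
        bilinear_map_of_linear_to_dual[OF V z] bilinear_map_signed_flip[OF V z]], of "1 / 2"]
  by (simp add: supersym_part_def[abs_def])

lemma supersym_part_homogeneous:
  assumes V: "super_vector_space L" and z: "linear_map L (dual L) z"
    and "x \<in> part L a" "y \<in> part L b"
  shows "supersym_part L z x y = 1 / 2 * (z x y + ksign (a * b) * z y x)"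
  using signed_homogeneous[OF V V super_vector_space_ground
      bilinear_map_flip[OF bilinear_map_of_linear_to_dual[OF V z]] assms(3,4)]
  by (simp add: supersym_part_def)

lemma supersymmetric_supersym_part:
  assumes V: "super_vector_space L" and z: "linear_map L (dual L) z"
  shows "supersymmetric L (supersym_part L z)"
  unfolding supersymmetric_def
proof (intro allI ballI)
  fix a b x y assume x: "x \<in> part L a" and y: "y \<in> part L b"
  show "supersym_part L z x y = ksign (a * b) * supersym_part L z y x"
    unfolding supersym_part_homogeneous[OF V z x y] supersym_part_homogeneous[OF V z y x]
    by (cases a; cases b) (simp_all add: ksign_def algebra_simps)
qed

text \<open>In the first term of the coboundary, \<open>\<pi>(x) z(y)\<close>, the sign \<open>(-1)\<^bsup>|x||y|\<^esup>\<close> of the coadjoint action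
  survives; in the second it meets the same sign in front of \<open>\<pi>(y) z(x)\<close> and cancels.\<close>

lemma coboundary_homogeneous:
  assumes L: "hom_lie_superalgebra L" and z: "z \<in> even_cochain1 L"
    and eq: "differ_by_coboundary L \<omega>\<^sub>1 \<omega>\<^sub>2 z"
    and x: "x \<in> part L a" and y: "y \<in> part L b" and w: "w \<in> space_of L"
  shows "\<omega>\<^sub>1 x y w - \<omega>\<^sub>2 x y w =
    - (ksign (a * b) * z y (brk L x w)) + z x (brk L y w) - z (brk L x y) w"
proof -
  note zp = even_cochain1_linear(2)[OF z]
  have "\<omega>\<^sub>1 x y - \<omega>\<^sub>2 x y =
        coadj L x (z y) - scal (dual L) (ksign (a * b)) (coadj L y (z x)) - z (brk L x y)"
    using eq x y by (simp add: differ_by_coboundary_def)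
  from fun_cong[OF this, of w] have "\<omega>\<^sub>1 x y w - \<omega>\<^sub>2 x y w =
        coadj L x (z y) w - ksign (a * b) * coadj L y (z x) w - z (brk L x y) w"
    by simp
  then show ?thesis
    unfolding coadj_homogeneous[OF L x zp[OF y] w] coadj_homogeneous[OF L y zp[OF x] w]
    by (simp add: mult.commute[of b a])
qed

text \<open>Write \<open>D(x, y, w)\<close> for the value of the coboundary.  Both \<open>D(x, y, w)\<close> and
  \<open>(-1)\<^bsup>|x|(|y| + |w|)\<^esup> D(y, w, x)\<close> contain the term \<open>- (-1)\<^bsup>|x||y|\<^esup> z(y)([x, w])\<close>.  After it is cancelled
  from the equation between them, the other four terms are those of the invariance equation.\<close>

lemma supersym_part_invariant_homogeneous:
  assumes L: "hom_lie_superalgebra L" and z: "z \<in> even_cochain1 L"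
    and cyc1: "supercyclic L \<omega>\<^sub>1" and cyc2: "supercyclic L \<omega>\<^sub>2"
    and eq: "differ_by_coboundary L \<omega>\<^sub>1 \<omega>\<^sub>2 z"
    and x: "x \<in> part L a" and y: "y \<in> part L b" and w: "w \<in> part L c"
  shows "supersym_part L z (brk L x y) w = supersym_part L z x (brk L y w)"
proof -
  note V = hom_lie_superalgebra_space[OF L]
  note zl = even_cochain1_linear(1)[OF z]
  note deg = hom_lie_superalgebra_brk(2)[OF L]
  have neg: "z u (brk L s t) = - (ksign (d * e) * z u (brk L t s))"
    if u: "u \<in> space_of L" and s: "s \<in> part L d" and t: "t \<in> part L e" for u s t d e
  proof -
    have "brk L s t = - scal L (ksign (d * e)) (brk L t s)"
      using L s t unfolding hom_lie_superalgebra_def by blast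
    moreover have "linear_map L ground (z u)"
      using bilinear_map_linear_right[OF bilinear_map_of_linear_to_dual[OF V zl] u] .
    moreover have "brk L t s \<in> space_of L" using deg[OF t s] part_in_space_of[OF V] by blast
    ultimately show ?thesis
      using linear_map_minus[OF V super_vector_space_ground] linear_map_scal space_of_scal[OF V]
      by (metis scal_ground)
  qed
  note in_L = part_in_space_of[OF V]
  have "\<omega>\<^sub>1 x y w - \<omega>\<^sub>2 x y w = ksign (a * (b + c)) * (\<omega>\<^sub>1 y w x - \<omega>\<^sub>2 y w x)"
    using cyc1 cyc2 x y w unfolding supercyclic_def by (metis right_diff_distrib)
  \<comment> \<open>The brackets of \<open>D(y, w, x)\<close> are reversed so that both sides use \<open>[x, y]\<close>, \<open>[y, w]\<close> and \<open>[x, w]\<close>.\<close>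
  then have cyc: "- (ksign (a * b) * z y (brk L x w)) + z x (brk L y w) - z (brk L x y) w =
      ksign (a * (b + c)) *
        (ksign (b * c) * (ksign (a * b) * z w (brk L x y)) - ksign (a * c) * z y (brk L x w)
         - z (brk L y w) x)"
    unfolding coboundary_homogeneous[OF L z eq x y in_L[OF w]]
      coboundary_homogeneous[OF L z eq y w in_L[OF x]]
      neg[OF in_L[OF w] y x] neg[OF in_L[OF y] w x]
    by (simp add: mult.commute[of b a] mult.commute[of c a])
  show ?thesis
    using cyc unfolding supersym_part_homogeneous[OF V zl deg[OF x y] w]
      supersym_part_homogeneous[OF V zl x deg[OF y w]]
    by (cases a; cases b; cases c) (simp_all add: ksign_def algebra_simps)
qed

lemma invariant_supersym_part:
  assumes L: "hom_lie_superalgebra L" and z: "z \<in> even_cochain1 L"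
    and cyc1: "supercyclic L \<omega>\<^sub>1" and cyc2: "supercyclic L \<omega>\<^sub>2"
    and eq: "differ_by_coboundary L \<omega>\<^sub>1 \<omega>\<^sub>2 z"
  shows "invariant L (supersym_part L z)"
proof -
  note V = hom_lie_superalgebra_space[OF L] and B = hom_lie_superalgebra_brk(1)[OF L]
  let ?q = "supersym_part L z"
  have q: "bilinear_map L L ground ?q"
    by (rule bilinear_map_supersym_part[OF V even_cochain1_linear(1)[OF z]])
  have id: "linear_map L L (\<lambda>x. x)" by (simp add: linear_map_def)
  have hom: "?q (brk L x y) w = ?q x (brk L y w)"
    if x: "x \<in> part L a" and "y \<in> space_of L" "w \<in> space_of L" for x a y w
  proof (rule bilinear_map_eqI_homogeneous[OF V V _ _ _ that(2,3)])
    note xs = part_in_space_of[OF V x]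
    show "bilinear_map L L ground (\<lambda>y w. ?q (brk L x y) w)"
      by (rule bilinear_map_comp_args[OF q bilinear_map_linear_right[OF B xs] id])
    show "bilinear_map L L ground (\<lambda>y w. ?q x (brk L y w))"
      by (rule bilinear_map_comp_value[OF B bilinear_map_linear_right[OF q xs]])
    show "?q (brk L x y) w = ?q x (brk L y w)" if "y \<in> part L b" "w \<in> part L c" for y w b c
      by (rule supersym_part_invariant_homogeneous[OF L z cyc1 cyc2 eq x that])
  qed
  show ?thesis
    unfolding invariant_def
  proof (intro ballI)
    fix x y w assume x: "x \<in> space_of L" and y: "y \<in> space_of L" and w: "w \<in> space_of L"
    show "?q (brk L x y) w = ?q x (brk L y w)"
    proof (rule linear_map_eqI_homogeneous[OF V _ _ _ x])
      show "linear_map L ground (\<lambda>x. ?q (brk L x y) w)"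
        by (rule linear_map_comp[OF bilinear_map_linear_left[OF B y] bilinear_map_linear_left[OF q w]])
      show "linear_map L ground (\<lambda>x. ?q x (brk L y w))"
        by (rule bilinear_map_linear_left[OF q bilinear_map_in[OF B y w]])
    qed (use hom y w in blast)
  qed
qed

text \<open>The form pairs an element of \<open>L\<close> with a functional using the sign of their degrees.  Since \<open>z\<close> is
  even, \<open>z(y)\<close> has the degree of \<open>y\<close>, which turns the pairing of \<open>x\<close> with \<open>z(y)\<close> into the signed
  transpose of \<open>z\<close>.\<close>

lemma q_form_shear:
  assumes L: "hom_lie_superalgebra L" and z: "z \<in> even_cochain1 L"
    and "u \<in> space_of (Tstar L \<omega>)" "v \<in> space_of (Tstar L \<omega>)"
  shows "q_form L (shear z u) (shear z v) =
    q_form L u v + (z (fst u) (fst v) + signed (*) L L (\<lambda>x y. z y x) (fst u) (fst v))"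
proof -
  note V = hom_lie_superalgebra_space[OF L]
  note D = super_vector_space_dual[OF V]
  let ?S = "signed (*) L (dual L) (\<lambda>x g. g x)"
  obtain x f y g where uv: "u = (x, f)" "v = (y, g)" by fastforce
  then have mem: "x \<in> space_of L" "f \<in> space_of (dual L)" "y \<in> space_of L" "g \<in> space_of (dual L)"
    using assms by auto
  have S: "bilinear_map L (dual L) ground ?S"
    using bilinear_map_signed[OF V D super_vector_space_ground bilinear_map_evaluation[OF V]] by simp
  have "?S x (z y + g) = ?S x (z y) + ?S x g"
    using mem linear_map_in[OF even_cochain1_linear(1)[OF z]]
      linear_map_add[OF bilinear_map_linear_right[OF S]] by blast
  moreover have "?S x (z y) = signed (*) L L (\<lambda>x y. z y x) x y"
    using even_linear_map_hcomp[OF V D _ mem(3)] z by (simp add: signed_def even_cochain1_def)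
  ultimately show ?thesis by (simp add: uv q_form_def shear_def)
qed

lemma shear_isometry_iff:
  fixes L :: "('k::field, 'v::ab_group_add) hom_superalgebra"
  assumes char: "CHAR('k) \<noteq> 2" and L: "hom_lie_superalgebra L" and z: "z \<in> even_cochain1 L"
  shows "(\<forall>u\<in>space_of (Tstar L \<omega>). \<forall>v\<in>space_of (Tstar L \<omega>).
       q_form L (shear z u) (shear z v) = q_form L u v) \<longleftrightarrow>
     (\<forall>x\<in>space_of L. \<forall>y\<in>space_of L. supersym_part L z x y = 0)"
proof -
  note D = super_vector_space_dual[OF hom_lie_superalgebra_space[OF L]]
  have "(2 :: 'k) \<noteq> 0"
  proof
    assume "(2 :: 'k) = 0"
    then have dvd: "CHAR('k) dvd 2"
      using of_nat_eq_0_iff_char_dvd[of 2, where 'a = 'k] by simp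
    then have "CHAR('k) \<le> 2" by (rule dvd_imp_le) simp
    then have "CHAR('k) = 0 \<or> CHAR('k) = 1" using char by linarith
    then show False using dvd by auto
  qed
  then have "supersym_part L z x y = 0 \<longleftrightarrow> z x y + signed (*) L L (\<lambda>x y. z y x) x y = 0" for x y
    by (simp add: supersym_part_def)
  then show ?thesis
    using q_form_shear[OF L z, of _ \<omega>] space_of_zero[OF D] by auto
qed

theorem proposition4p12:
  fixes L :: "('k::field, 'v::ab_group_add) hom_superalgebra"
    and \<omega>\<^sub>1 \<omega>\<^sub>2 :: "'v \<Rightarrow> 'v \<Rightarrow> 'v \<Rightarrow> 'k"
  assumes "CHAR('k) \<noteq> 2"
    and "hom_lie_superalgebra L"
    and "coadjoint_exists L"
    and "even_cocycle2 L \<omega>\<^sub>1" and "supercyclic L \<omega>\<^sub>1"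
    and "even_cocycle2 L \<omega>\<^sub>2" and "supercyclic L \<omega>\<^sub>2"
  shows
    "(Tstar_equivalent L \<omega>\<^sub>1 \<omega>\<^sub>2 \<longleftrightarrow>
        (\<exists>z\<in>even_cochain1 L. twist_compatible L z \<and> differ_by_coboundary L \<omega>\<^sub>1 \<omega>\<^sub>2 z)) \<and>
     (\<forall>z\<in>even_cochain1 L. differ_by_coboundary L \<omega>\<^sub>1 \<omega>\<^sub>2 z \<longrightarrow>
        bilinear_map L L ground (supersym_part L z) \<and>
        supersymmetric L (supersym_part L z) \<and>
        invariant L (supersym_part L z)) \<and>
     (Tstar_isometrically_equivalent L \<omega>\<^sub>1 \<omega>\<^sub>2 \<longleftrightarrow>
        (\<exists>z\<in>even_cochain1 L. twist_compatible L z \<and> differ_by_coboundary L \<omega>\<^sub>1 \<omega>\<^sub>2 z \<and>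
           (\<forall>x\<in>space_of L. \<forall>y\<in>space_of L. supersym_part L z x y = 0)))"
proof -
  note L = assms(2)
  note V = hom_lie_superalgebra_space[OF L]
  have \<omega>: "bilinear_map L L (dual L) \<omega>\<^sub>1" "bilinear_map L L (dual L) \<omega>\<^sub>2"
    using assms(4,6) unfolding even_cocycle2_def even_bilinear_map_def by blast+
  note shear_iff = equivalence_map_shear_iff[OF L _ \<omega>]
  have is_shear: "\<exists>z\<in>even_cochain1 L. equivalence_map L \<omega>\<^sub>1 \<omega>\<^sub>2 (shear z) \<and>
      (\<forall>u\<in>space_of (Tstar L \<omega>\<^sub>1). \<phi> u = shear z u)" if "equivalence_map L \<omega>\<^sub>1 \<omega>\<^sub>2 \<phi>" for \<phi>
    using equivalence_map_is_shear[OF L that] equivalence_map_cong[OF L \<omega>(1) _ that] by metis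
  have isometry_iff: "(\<forall>u\<in>space_of (Tstar L \<omega>\<^sub>1). \<forall>v\<in>space_of (Tstar L \<omega>\<^sub>1).
       q_form L (shear z u) (shear z v) = q_form L u v) \<longleftrightarrow>
     (\<forall>x\<in>space_of L. \<forall>y\<in>space_of L. supersym_part L z x y = 0)" if "z \<in> even_cochain1 L" for z
    by (rule shear_isometry_iff[OF assms(1) L that])
  have "Tstar_equivalent L \<omega>\<^sub>1 \<omega>\<^sub>2 \<longleftrightarrow>
      (\<exists>z\<in>even_cochain1 L. equivalence_map L \<omega>\<^sub>1 \<omega>\<^sub>2 (shear z))"
    unfolding Tstar_equivalent_def using is_shear by blast
  then have equivalent: "Tstar_equivalent L \<omega>\<^sub>1 \<omega>\<^sub>2 \<longleftrightarrow>
      (\<exists>z\<in>even_cochain1 L. twist_compatible L z \<and> differ_by_coboundary L \<omega>\<^sub>1 \<omega>\<^sub>2 z)"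
    by (simp add: shear_iff cong: bex_cong)
  have "Tstar_isometrically_equivalent L \<omega>\<^sub>1 \<omega>\<^sub>2 \<longleftrightarrow>
      (\<exists>z\<in>even_cochain1 L. equivalence_map L \<omega>\<^sub>1 \<omega>\<^sub>2 (shear z) \<and>
        (\<forall>u\<in>space_of (Tstar L \<omega>\<^sub>1). \<forall>v\<in>space_of (Tstar L \<omega>\<^sub>1).
           q_form L (shear z u) (shear z v) = q_form L u v))" (is "_ \<longleftrightarrow> ?rhs")
    unfolding Tstar_isometrically_equivalent_def
  proof
    assume "\<exists>\<phi>. equivalence_map L \<omega>\<^sub>1 \<omega>\<^sub>2 \<phi> \<and>
        (\<forall>u\<in>space_of (Tstar L \<omega>\<^sub>1). \<forall>v\<in>space_of (Tstar L \<omega>\<^sub>1).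
           q_form L (\<phi> u) (\<phi> v) = q_form L u v)"
    then obtain \<phi> where "equivalence_map L \<omega>\<^sub>1 \<omega>\<^sub>2 \<phi>"
      and iso: "\<forall>u\<in>space_of (Tstar L \<omega>\<^sub>1). \<forall>v\<in>space_of (Tstar L \<omega>\<^sub>1).
        q_form L (\<phi> u) (\<phi> v) = q_form L u v"
      by blast
    then obtain z where "z \<in> even_cochain1 L" "equivalence_map L \<omega>\<^sub>1 \<omega>\<^sub>2 (shear z)"
      "\<forall>u\<in>space_of (Tstar L \<omega>\<^sub>1). \<phi> u = shear z u"
      using is_shear by blast
    with iso show ?rhs by (intro bexI[of _ z]) (simp_all del: space_of_Tstar)
  qed blast
  then have "Tstar_isometrically_equivalent L \<omega>\<^sub>1 \<omega>\<^sub>2 \<longleftrightarrow>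
        (\<exists>z\<in>even_cochain1 L. twist_compatible L z \<and> differ_by_coboundary L \<omega>\<^sub>1 \<omega>\<^sub>2 z \<and>
           (\<forall>x\<in>space_of L. \<forall>y\<in>space_of L. supersym_part L z x y = 0))"
    by (simp add: shear_iff isometry_iff conj_assoc del: space_of_Tstar cong: bex_cong)
  then show ?thesis
    using equivalent bilinear_map_supersym_part[OF V] supersymmetric_supersym_part[OF V]
      invariant_supersym_part[OF L _ assms(5,7)] even_cochain1_linear(1) by (intro conjI ballI impI) blast+
qed

end
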